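(* Let $G=(V,V_0,V_1,E,c)$ be a parity game, let $X\subseteq V$ be a nonempty set of nodes all having the same color $c_X$, and let $p=c_X \bmod 2$. Suppose that $\mathrm{MAttr}(X)$ is fatal, i.e. $X\subseteq \mathrm{MAttr}(X)$. Then every attractor strategy of player $p$ for $\mathrm{MAttr}(X)$ is winning for player $p$ on $\mathrm{MAttr}(X)$: every play that starts in a node of $\mathrm{MAttr}(X)$ and is consistent with such a strategy is won by player $p$.
   Context: A parity game is a tuple $G=(V,V_0,V_1,E,c)$ where $V$ is a finite set of nodes partitioned into $V_0$ and $V_1$ (nodes owned by players $0$ and $1$), $E\subseteq V\times V$ is such that every node has at least one successor, and $c\colon V\to\mathbb{N}$ is a coloring. For $v\in V$ let $v.E=\{w\mid (v,w)\in E\}$. A play is an infinite sequence $v_0v_1\dots$ with $(v_i,v_{i+1})\in E$, where the owner of $v_i$ chooses $v_{i+1}$; player $0$ wins the play iff the minimal color occurring infinitely often is even, otherwise player $1$ wins. A strategy for player $p$ is a function $\tau\colon V_p\to V$ with $(v,\tau(v))\in E$; a play is consistent with $\tau$ if $v_{i+1}=\tau(v_i)$ whenever $v_i\in V_p$. For node sets $A,X$, player $p\in\{0,1\}$ and color $c$, define the monotone control predecessor $\mathrm{mpre}_p(A,X,c)=\{v\in V_p\mid c(v)\geq c \wedge v.E\cap(A\cup X)\neq\emptyset\}\cup\{v\in V_{1-p}\mid c(v)\geq c\wedge v.E\subseteq A\cup X\}$. For a nonempty set $X$ of nodes all of color $c_X$ with $p=c_X\bmod 2$, let $Z_0=\emptyset$,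 $Z_{i+1}=\mathrm{mpre}_p(Z_i,X,c_X)$, and $\mathrm{MAttr}(X)=\bigcup_i Z_i$ (the least fixed point of $Z\mapsto \mathrm{mpre}_p(Z,X,c_X)$; note $X$ itself is not added by default). $\mathrm{MAttr}(X)$ is called fatal if $X\subseteq\mathrm{MAttr}(X)$. An attractor strategy of player $p$ for $\mathrm{MAttr}(X)$ is a strategy that, at each node $v\in V_p\cap \mathrm{MAttr}(X)$ with $i\geq 1$ minimal such that $v\in Z_i$, moves to a successor of $v$ in $Z_{i-1}\cup X$ (such a successor exists by definition). *)

theory Defs
  imports Main
begin

record 'v pgame =
  nodes :: "'v set"
  nodes0 :: "'v set"
  nodes1 :: "'v set"
  edges :: "('v \<times> 'v) set"
  color :: "'v \<Rightarrow> nat"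

text \<open>One of the two blocks of the partition may be empty.\<close>

locale parity_game =
  fixes G :: "'v pgame"
  assumes finite_nodes: "finite (nodes G)"
    and nodes_union: "nodes0 G \<union> nodes1 G = nodes G"
    and nodes_disjoint: "nodes0 G \<inter> nodes1 G = {}"
    and edges_subset: "edges G \<subseteq> nodes G \<times> nodes G"
    and total: "\<And>v. v \<in> nodes G \<Longrightarrow> \<exists>w. (v, w) \<in> edges G"

text \<open>Players are the numbers 0 and 1, so the opponent of \<open>p\<close> is \<open>1 - p\<close>.\<close>

definition owned :: "'v pgame \<Rightarrow> nat \<Rightarrow> 'v set" where
  "owned G p = (if p = 0 then nodes0 G else nodes1 G)"

definition succs :: "'v pgame \<Rightarrow> 'v \<Rightarrow> 'v set" where
  "succs G v = {w. (v, w) \<in> edges G}"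

definition play :: "'v pgame \<Rightarrow> (nat \<Rightarrow> 'v) \<Rightarrow> bool" where
  "play G \<rho> \<longleftrightarrow> (\<forall>i. (\<rho> i, \<rho> (Suc i)) \<in> edges G)"

text \<open>In a finite game every play has a color that occurs infinitely often, so the
  \<open>LEAST\<close> below is well defined on plays.\<close>

definition min_inf_color :: "'v pgame \<Rightarrow> (nat \<Rightarrow> 'v) \<Rightarrow> nat" where
  "min_inf_color G \<rho> = (LEAST k. infinite {i. color G (\<rho> i) = k})"

definition winner :: "'v pgame \<Rightarrow> (nat \<Rightarrow> 'v) \<Rightarrow> nat" where
  "winner G \<rho> = (if even (min_inf_color G \<rho>) then 0 else 1)"

text \<open>A strategy of player \<open>p\<close> is a function on the nodes owned by \<open>p\<close>; its values
  elsewhere are irrelevant.\<close>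

definition strategy :: "'v pgame \<Rightarrow> nat \<Rightarrow> ('v \<Rightarrow> 'v) \<Rightarrow> bool" where
  "strategy G p \<tau> \<longleftrightarrow> (\<forall>v \<in> owned G p. (v, \<tau> v) \<in> edges G)"

definition consistent :: "'v pgame \<Rightarrow> nat \<Rightarrow> ('v \<Rightarrow> 'v) \<Rightarrow> (nat \<Rightarrow> 'v) \<Rightarrow> bool" where
  "consistent G p \<tau> \<rho> \<longleftrightarrow> (\<forall>i. \<rho> i \<in> owned G p \<longrightarrow> \<rho> (Suc i) = \<tau> (\<rho> i))"

definition winning_on :: "'v pgame \<Rightarrow> nat \<Rightarrow> ('v \<Rightarrow> 'v) \<Rightarrow> 'v set \<Rightarrow> bool" where
  "winning_on G p \<tau> W \<longleftrightarrow>
    (\<forall>\<rho>. play G \<rho> \<and> \<rho> 0 \<in> W \<and> consistent G p \<tau> \<rho> \<longrightarrow> winner G \<rho> = p)"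

definition mpre :: "'v pgame \<Rightarrow> nat \<Rightarrow> 'v set \<Rightarrow> 'v set \<Rightarrow> nat \<Rightarrow> 'v set" where
  "mpre G p A X k =
    {v \<in> owned G p. color G v \<ge> k \<and> succs G v \<inter> (A \<union> X) \<noteq> {}} \<union>
    {v \<in> owned G (1 - p). color G v \<ge> k \<and> succs G v \<subseteq> A \<union> X}"

text \<open>In the following definitions \<open>k\<close> is the common color of the nodes in \<open>X\<close>, which is
  determined by \<open>X\<close> whenever \<open>X\<close> is nonempty and monochromatic.\<close>

primrec mattr_stage :: "'v pgame \<Rightarrow> 'v set \<Rightarrow> nat \<Rightarrow> nat \<Rightarrow> 'v set" where
  "mattr_stage G X k 0 = {}"
| "mattr_stage G X k (Suc i) = mpre G (k mod 2) (mattr_stage G X k i) X k"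

definition mattr :: "'v pgame \<Rightarrow> 'v set \<Rightarrow> nat \<Rightarrow> 'v set" where
  "mattr G X k = (\<Union>i. mattr_stage G X k i)"

definition fatal :: "'v pgame \<Rightarrow> 'v set \<Rightarrow> nat \<Rightarrow> bool" where
  "fatal G X k \<longleftrightarrow> X \<subseteq> mattr G X k"

definition attractor_strategy ::
    "'v pgame \<Rightarrow> 'v set \<Rightarrow> nat \<Rightarrow> ('v \<Rightarrow> 'v) \<Rightarrow> bool" where
  "attractor_strategy G X k \<tau> \<longleftrightarrow>
    strategy G (k mod 2) \<tau> \<and>
    (\<forall>v \<in> owned G (k mod 2) \<inter> mattr G X k.
      let i = (LEAST i. 1 \<le> i \<and> v \<in> mattr_stage G X k i)
      in \<tau> v \<in> succs G v \<inter> (mattr_stage G X k (i - 1) \<union> X))"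

end

theory Submission
  imports Defs "HOL-Library.Infinite_Set"
begin

text \<open>The stage at which a node enters the attractor strictly decreases along a consistent
  play until \<open>X\<close> is reached, and fatality puts every node of \<open>X\<close> back into the attractor.
  So the play never leaves the attractor, visits \<open>X\<close> infinitely often, and never sees a color
  below that of \<open>X\<close>.\<close>

definition mattr_rank :: "'v pgame \<Rightarrow> 'v set \<Rightarrow> nat \<Rightarrow> 'v \<Rightarrow> nat" where
  "mattr_rank G X k v = (LEAST i. v \<in> mattr_stage G X k i)"

lemma mattr_stage_rank:
  assumes "v \<in> mattr G X k"
  shows "v \<in> mattr_stage G X k (mattr_rank G X k v)"
  using assms unfolding mattr_def mattr_rank_def by (auto intro: LeastI)

lemma mattr_rank_le: "v \<in> mattr_stage G X k i \<Longrightarrow> mattr_rank G X k v \<le> i"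
  unfolding mattr_rank_def by (rule Least_le)

text \<open>Stage 0 is empty and every later stage is a value of \<open>mpre\<close>, which filters
  by color; \<open>X\<close> is not added by default.\<close>

lemma mattr_color_ge:
  assumes "v \<in> mattr G X k"
  shows "k \<le> color G v"
proof -
  obtain i where "v \<in> mattr_stage G X k i"
    using assms unfolding mattr_def by auto
  then show ?thesis by (cases i) (auto simp: mpre_def)
qed

text \<open>A node of rank \<open>Suc j\<close> lies in \<open>mpre\<close> of stage
  \<open>j\<close>, so the move of the strategy, or any move of the opponent, leads to stage
  \<open>j\<close> or into \<open>X\<close>. Nothing is claimed about the rank in \<open>X\<close>,
  where it may jump up again.\<close>

lemma mattr_step:
  assumes "attractor_strategy G X k \<tau>" and "v \<in> mattr G X k" and "(v, w) \<in> edges G"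
    and "v \<in> owned G (k mod 2) \<Longrightarrow> w = \<tau> v"
  shows "w \<in> X \<or> w \<in> mattr G X k \<and> mattr_rank G X k w < mattr_rank G X k v"
proof -
  obtain j where rank: "mattr_rank G X k v = Suc j"
    using mattr_stage_rank[OF assms(2)] by (cases "mattr_rank G X k v") auto
  have v: "v \<in> mpre G (k mod 2) (mattr_stage G X k j) X k"
    using mattr_stage_rank[OF assms(2)] rank by simp
  \<comment> \<open>This identifies the index in \<open>attractor_strategy\<close> with the rank,
    which is positive because stage 0 is empty; hence \<open>i - 1\<close> there is
    \<open>j\<close>.\<close>
  have least: "(LEAST i. 1 \<le> i \<and> v \<in> mattr_stage G X k i) = Suc j"
    using v mattr_rank_le[of v G X k] rank by (intro Least_equality) auto
  have "w \<in> mattr_stage G X k j \<union> X"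
  proof (cases "v \<in> owned G (k mod 2)")
    case True
    then have "\<tau> v \<in> mattr_stage G X k (Suc j - 1) \<union> X"
      using assms(1,2) unfolding attractor_strategy_def Let_def least[symmetric] by blast
    then show ?thesis using assms(4) True by simp
  next
    case False
    then show ?thesis
      using v assms(3) by (auto simp: mpre_def succs_def)
  qed
  then show ?thesis
    using rank mattr_rank_le[of w G X k j] by (auto simp: mattr_def)
qed

text \<open>The color \<open>k\<close> recurs forever, and a color that occurs infinitely often
  occurs at least once, so it cannot be below \<open>k\<close>.\<close>

lemma min_inf_color_eqI:
  assumes "\<And>i. k \<le> color G (\<rho> i)" and "\<And>n. \<exists>m\<ge>n. color G (\<rho> m) = k"
  shows "min_inf_color G \<rho> = k"
  unfolding min_inf_color_def
proof (rule Least_equality)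
  show "infinite {i. color G (\<rho> i) = k}"
    using assms(2) by (simp add: infinite_nat_iff_unbounded_le)
next
  fix y assume "infinite {i. color G (\<rho> i) = y}"
  then obtain i where "color G (\<rho> i) = y"
    using infinite_imp_nonempty by fastforce
  then show "k \<le> y" using assms(1) by blast
qed

theorem theorem2:
  fixes G :: "'v pgame" and X :: "'v set" and c_X p :: nat and \<tau> :: "'v \<Rightarrow> 'v"
  assumes "parity_game G"
    and "X \<subseteq> nodes G" and "X \<noteq> {}"
    and "\<forall>v \<in> X. color G v = c_X"
    and "p = c_X mod 2"
    and "fatal G X c_X"
    and "attractor_strategy G X c_X \<tau>"
  shows "winning_on G p \<tau> (mattr G X c_X)"
  unfolding winning_on_def
proof (intro allI impI, elim conjE)
  fix \<rho>
  assume play: "play G \<rho>" and start: "\<rho> 0 \<in> mattr G X c_X" and cons: "consistent G p \<tau> \<rho>"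
  have step: "\<rho> (Suc i) \<in> X \<or>
      \<rho> (Suc i) \<in> mattr G X c_X \<and> mattr_rank G X c_X (\<rho> (Suc i)) < mattr_rank G X c_X (\<rho> i)"
    if "\<rho> i \<in> mattr G X c_X" for i
    using play cons assms(5) that
    by (intro mattr_step[OF assms(7)]) (auto simp: play_def consistent_def)
  have stays: "\<rho> i \<in> mattr G X c_X" for i
  proof (induction i)
    case (Suc i)
    then show ?case using step assms(6) unfolding fatal_def by blast
  qed (rule start)
  have visits: "\<exists>m\<ge>n. \<rho> m \<in> X" for n
  \<comment> \<open>Either \<open>m = Suc n\<close> is a visit to \<open>X\<close>, or the rank has
    dropped and the induction hypothesis applies at \<open>Suc n\<close>; hence \<open>n\<close> is
    arbitrary.\<close>
  proof (induction "mattr_rank G X c_X (\<rho> n)" arbitrary: n rule: less_induct)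
    case less
    then show ?case using step[OF stays, of n] by (meson Suc_leD le_SucI order_refl)
  qed
  \<comment> \<open>Staying in the attractor gives the lower bound on colors; \<open>X\<close> being
    monochromatic turns visits to \<open>X\<close> into recurrences of \<open>c_X\<close>.\<close>
  have "min_inf_color G \<rho> = c_X"
    using mattr_color_ge[OF stays] visits assms(4) by (intro min_inf_color_eqI) blast+
  then show "winner G \<rho> = p"
    using assms(5) by (simp add: winner_def even_iff_mod_2_eq_zero odd_iff_mod_2_eq_one)
qed

end
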